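(* For any unrestricted $\lambda_\epsilon$-terms $s,t,e$ and any variable $x$ which does not occur free in $e$, $$s[t+\epsilon e/x]\ \sim_\epsilon\ s[t/x]+\epsilon\left(\left(\frac{\partial s}{\partial x}(e)\right)[t/x]\right).$$
   Context: Unrestricted terms of the $\lambda_\epsilon$-calculus are generated by the grammar $t ::= x \mid \lambda x.t \mid (s\ t) \mid \mathsf{D}(s)\cdot t \mid \epsilon t \mid s+t \mid 0$, over a countably infinite set of variables; $\lambda$ is the only binder, terms are considered up to $\alpha$-equivalence, and bound variables are chosen distinct from free ones. Capture-avoiding substitution $t[s/x]$ is the usual one (it replaces free occurrences of $x$ by $s$ and commutes with all constructors, renaming bound variables as needed). Differential substitution $\frac{\partial t}{\partial x}(s)$, defined when $x$ is not free in $s$, is given by induction on $t$: $\frac{\partial x}{\partial x}(s)=s$; $\frac{\partial y}{\partial x}(s)=0$ for $y\neq x$; $\frac{\partial(\lambda y.t)}{\partial x}(s)=\lambda y.\frac{\partial t}{\partial x}(s)$ (with $y\ne x$ not free in $s$); $\frac{\partial(t\ e)}{\partial x}(s)=\big((\mathsf{D}(t)\cdot\frac{\partial e}{\partial x}(s))\ e\big)+\big(\frac{\partial t}{\partial x}(s)\ (e[x+\epsilon s/x])\big)$; $\frac{\partial(\mathsf{D}(t)\cdot e)}{\partial x}(s)=\mathsf{D}(t)\cdot\frac{\partial e}{\partial x}(s)+\mathsf{D}(\frac{\partial t}{\partial x}(s))\cdot(e[x+\epsilon s/x])+\epsilon\big(\mathsf{D}(\mathsf{D}(t)\cdot e)\cdot\frac{\partial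 e}{\partial x}(s)\big)$; $\frac{\partial(\epsilon t)}{\partial x}(s)=\epsilon\frac{\partial t}{\partial x}(s)$; $\frac{\partial(t+e)}{\partial x}(s)=\frac{\partial t}{\partial x}(s)+\frac{\partial e}{\partial x}(s)$; $\frac{\partial 0}{\partial x}(s)=0$. A binary relation $\sim$ on terms is contextual if $t\sim t'$ implies $\lambda x.t\sim\lambda x.t'$ and $\epsilon t\sim\epsilon t'$, and $s\sim s'$, $t\sim t'$ imply $(s\ t)\sim(s'\ t')$, $\mathsf{D}(s)\cdot t\sim\mathsf{D}(s')\cdot t'$ and $s+t\sim s'+t'$. We write $\epsilon^k t$ for $k$-fold application of $\epsilon$. Differential equivalence $\sim_\epsilon$ is the least contextual equivalence relation containing the following pairs (for all terms $s,t,e$ and variables $x$): $(s+t)+e\sim s+(t+e)$; $s+0\sim s$; $s+t\sim t+s$; $\epsilon 0\sim 0$; $\epsilon(s+t)\sim\epsilon s+\epsilon t$; $\lambda x.0\sim 0$; $\lambda x.(s+t)\sim(\lambda x.s)+(\lambda x.t)$; $\lambda x.\epsilon t\sim\epsilon(\lambda x.t)$; $(0\ s)\sim 0$; $((s+t)\ e)\sim(s\ e)+(t\ e)$; $((\epsilon s)\ t)\sim\epsilon(s\ t)$; $\mathsf{D}(0)\cdot e\sim 0$; $\mathsf{D}(s+t)\cdot e\sim(\mathsf{D}(s)\cdot e)+(\mathsf{D}(t)\cdot e)$; $\mathsf{D}(\epsilon t)\cdot e\sim\epsilon(\mathsf{D}(t)\cdot e)$; $\mathsf{D}(s)\cdot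 0\sim 0$; $\mathsf{D}(s)\cdot(t+e)\sim\mathsf{D}(s)\cdot t+\mathsf{D}(s)\cdot e+\epsilon(\mathsf{D}(\mathsf{D}(s)\cdot t)\cdot e)$; $\mathsf{D}(s)\cdot(\epsilon t)\sim\epsilon(\mathsf{D}(s)\cdot t)$; $\mathsf{D}(\mathsf{D}(s)\cdot t)\cdot e\sim\mathsf{D}(\mathsf{D}(s)\cdot e)\cdot t$; $\epsilon^2(\mathsf{D}(\mathsf{D}(s)\cdot t)\cdot e)\sim\epsilon(\mathsf{D}(\mathsf{D}(s)\cdot t)\cdot e)$; $(s\ (t+\epsilon e))\sim(s\ t)+\epsilon((\mathsf{D}(s)\cdot e)\ t)$. *)

theory Defs
  imports Main
begin

text \<open>
  Terms up to \<open>\<alpha>\<close>-equivalence are de Bruijn terms, with the natural numbers as the countable set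
  of variables: under \<open>k\<close> binders the free variable \<open>x\<close> appears as the index \<open>x + k\<close>. The abstraction
  \<open>\<lambda>x. t\<close> over a named variable is \<open>lam x t\<close> below. The lemmas about \<open>lam\<close> at the end show that
  \<open>\<alpha>\<close>-renaming and the usual named clauses for free variables, both substitutions and
  the equivalence hold for it.
\<close>

datatype tm =
    Var nat
  | Lam tm
  | App tm tm
  | D tm tm  \<comment> \<open>\<open>D s t\<close> is \<open>D(s) \<cdot> t\<close>\<close>
  | Eps tm
  | Plus tm tm  (infixl "\<oplus>" 65)
  | Zero

primrec fv :: "tm \<Rightarrow> nat set" where
  "fv (Var y) = {y}"
| "fv (Lam t) = {y. Suc y \<in> fv t}"
| "fv (App t e) = fv t \<union> fv e"
| "fv (D t e) = fv t \<union> fv e"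
| "fv (Eps t) = fv t"
| "fv (t \<oplus> e) = fv t \<union> fv e"
| "fv Zero = {}"

primrec rename :: "(nat \<Rightarrow> nat) \<Rightarrow> tm \<Rightarrow> tm" where
  "rename f (Var y) = Var (f y)"
| "rename f (Lam t) = Lam (rename (case_nat 0 (\<lambda>y. Suc (f y))) t)"
| "rename f (App t e) = App (rename f t) (rename f e)"
| "rename f (D t e) = D (rename f t) (rename f e)"
| "rename f (Eps t) = Eps (rename f t)"
| "rename f (t \<oplus> e) = rename f t \<oplus> rename f e"
| "rename f Zero = Zero"

abbreviation lift :: "tm \<Rightarrow> tm" where
  "lift \<equiv> rename Suc"

definition lam :: "nat \<Rightarrow> tm \<Rightarrow> tm" where
  "lam x t = Lam (rename (\<lambda>y. if y = x then 0 else Suc y) t)"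

text \<open>
  \<open>t[x ::= s]\<close> is \<open>t[s/x]\<close>. The other free variables keep their names: unlike the
  substitution used for \<open>\<beta>\<close>-reduction of de Bruijn terms, it does not lower any index.
\<close>

primrec subst :: "tm \<Rightarrow> nat \<Rightarrow> tm \<Rightarrow> tm"  ("_[_ ::= _]" [1000, 0, 0] 1000) where
  "(Var y)[x ::= s] = (if y = x then s else Var y)"
| "(Lam t)[x ::= s] = Lam (t[Suc x ::= lift s])"
| "(App t e)[x ::= s] = App (t[x ::= s]) (e[x ::= s])"
| "(D t e)[x ::= s] = D (t[x ::= s]) (e[x ::= s])"
| "(Eps t)[x ::= s] = Eps (t[x ::= s])"
| "(t \<oplus> e)[x ::= s] = t[x ::= s] \<oplus> e[x ::= s]"
| "Zero[x ::= s] = Zero"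

text \<open>
  \<open>dsubst t x s\<close> is \<open>(\<partial>t/\<partial>x)(s)\<close>; it is meaningful only if \<open>x \<notin> fv s\<close>.
\<close>

primrec dsubst :: "tm \<Rightarrow> nat \<Rightarrow> tm \<Rightarrow> tm" where
  "dsubst (Var y) x s = (if y = x then s else Zero)"
| "dsubst (Lam t) x s = Lam (dsubst t (Suc x) (lift s))"
| "dsubst (App t e) x s =
     App (D t (dsubst e x s)) e \<oplus> App (dsubst t x s) (e[x ::= Var x \<oplus> Eps s])"
| "dsubst (D t e) x s =
     D t (dsubst e x s) \<oplus> D (dsubst t x s) (e[x ::= Var x \<oplus> Eps s])
       \<oplus> Eps (D (D t e) (dsubst e x s))"
| "dsubst (Eps t) x s = Eps (dsubst t x s)"
| "dsubst (t \<oplus> e) x s = dsubst t x s \<oplus> dsubst e x s"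
| "dsubst Zero x s = Zero"

inductive deq :: "tm \<Rightarrow> tm \<Rightarrow> bool"  (infix "\<sim>\<^sub>\<epsilon>" 50) where
  refl: "t \<sim>\<^sub>\<epsilon> t"
| sym: "s \<sim>\<^sub>\<epsilon> t \<Longrightarrow> t \<sim>\<^sub>\<epsilon> s"
| trans: "s \<sim>\<^sub>\<epsilon> t \<Longrightarrow> t \<sim>\<^sub>\<epsilon> e \<Longrightarrow> s \<sim>\<^sub>\<epsilon> e"
| cong_Lam: "t \<sim>\<^sub>\<epsilon> t' \<Longrightarrow> Lam t \<sim>\<^sub>\<epsilon> Lam t'"
| cong_Eps: "t \<sim>\<^sub>\<epsilon> t' \<Longrightarrow> Eps t \<sim>\<^sub>\<epsilon> Eps t'"
| cong_App: "s \<sim>\<^sub>\<epsilon> s' \<Longrightarrow> t \<sim>\<^sub>\<epsilon> t' \<Longrightarrow> App s t \<sim>\<^sub>\<epsilon> App s' t'"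
| cong_D: "s \<sim>\<^sub>\<epsilon> s' \<Longrightarrow> t \<sim>\<^sub>\<epsilon> t' \<Longrightarrow> D s t \<sim>\<^sub>\<epsilon> D s' t'"
| cong_Plus: "s \<sim>\<^sub>\<epsilon> s' \<Longrightarrow> t \<sim>\<^sub>\<epsilon> t' \<Longrightarrow> s \<oplus> t \<sim>\<^sub>\<epsilon> s' \<oplus> t'"
| Plus_assoc: "(s \<oplus> t) \<oplus> e \<sim>\<^sub>\<epsilon> s \<oplus> (t \<oplus> e)"
| Plus_Zero: "s \<oplus> Zero \<sim>\<^sub>\<epsilon> s"
| Plus_comm: "s \<oplus> t \<sim>\<^sub>\<epsilon> t \<oplus> s"
| Eps_Zero: "Eps Zero \<sim>\<^sub>\<epsilon> Zero"
| Eps_Plus: "Eps (s \<oplus> t) \<sim>\<^sub>\<epsilon> Eps s \<oplus> Eps t"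
| Lam_Zero: "Lam Zero \<sim>\<^sub>\<epsilon> Zero"
| Lam_Plus: "Lam (s \<oplus> t) \<sim>\<^sub>\<epsilon> Lam s \<oplus> Lam t"
| Lam_Eps: "Lam (Eps t) \<sim>\<^sub>\<epsilon> Eps (Lam t)"
| App_Zero: "App Zero s \<sim>\<^sub>\<epsilon> Zero"
| App_Plus: "App (s \<oplus> t) e \<sim>\<^sub>\<epsilon> App s e \<oplus> App t e"
| App_Eps: "App (Eps s) t \<sim>\<^sub>\<epsilon> Eps (App s t)"
| D_Zero: "D Zero e \<sim>\<^sub>\<epsilon> Zero"
| D_Plus: "D (s \<oplus> t) e \<sim>\<^sub>\<epsilon> D s e \<oplus> D t e"
| D_Eps: "D (Eps t) e \<sim>\<^sub>\<epsilon> Eps (D t e)"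
| D_Zero_right: "D s Zero \<sim>\<^sub>\<epsilon> Zero"
| D_Plus_right: "D s (t \<oplus> e) \<sim>\<^sub>\<epsilon> D s t \<oplus> D s e \<oplus> Eps (D (D s t) e)"
| D_Eps_right: "D s (Eps t) \<sim>\<^sub>\<epsilon> Eps (D s t)"
| D_comm: "D (D s t) e \<sim>\<^sub>\<epsilon> D (D s e) t"
| Eps_Eps_D: "Eps (Eps (D (D s t) e)) \<sim>\<^sub>\<epsilon> Eps (D (D s t) e)"
| App_Taylor: "App s (t \<oplus> Eps e) \<sim>\<^sub>\<epsilon> App s t \<oplus> Eps (App (D s e) t)"

lemma rename_cong: "(\<And>y. y \<in> fv t \<Longrightarrow> f y = g y) \<Longrightarrow> rename f t = rename g t"
proof (induction t arbitrary: f g)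
  case (Lam t)
  show ?case
    by (auto intro!: Lam.IH Lam.prems split: nat.split)
next
  case (App t e)
  then show ?case by (metis UnCI fv.simps(3) rename.simps(3))
next
  case (D t e)
  then show ?case by (metis UnCI fv.simps(4) rename.simps(4))
next
  case (Plus t e)
  then show ?case by (metis UnCI fv.simps(6) rename.simps(6))
next
  case (Eps t)
  then show ?case by (metis fv.simps(5) rename.simps(5))
qed simp_all

lemma rename_rename: "rename f (rename g t) = rename (\<lambda>y. f (g y)) t"
proof (induction t arbitrary: f g)
  case (Lam t)
  show ?case
    by (auto simp: Lam.IH intro!: rename_cong split: nat.split)
qed simp_all

lemma rename_id: "rename (\<lambda>y. y) t = t"
proof (induction t)
  case (Lam t)
  have "case_nat 0 (\<lambda>y. Suc y) = (\<lambda>y. y)"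
    by (rule ext) (simp split: nat.split)
  then show ?case using Lam by simp
qed simp_all

lemma fv_rename: "fv (rename f t) = f ` fv t"
proof (induction t arbitrary: f)
  case (Lam t)
  show ?case
    by (force simp: Lam.IH split: nat.splits)
qed auto

lemma inj_under_binder: "inj f \<Longrightarrow> inj (case_nat 0 (\<lambda>y. Suc (f y)))"
  by (rule injI) (auto dest: injD split: nat.splits)

lemma rename_subst: "inj f \<Longrightarrow> rename f (t[x ::= s]) = (rename f t)[f x ::= rename f s]"
proof (induction t arbitrary: f x s)
  case (Lam t)
  show ?case
    using Lam.IH[OF inj_under_binder[OF Lam.prems]] by (simp add: rename_rename)
qed (simp_all add: inj_eq)

lemma rename_dsubst: "inj f \<Longrightarrow> rename f (dsubst t x s) = dsubst (rename f t) (f x) (rename f s)"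
proof (induction t arbitrary: f x s)
  case (Lam t)
  show ?case
    using Lam.IH[OF inj_under_binder[OF Lam.prems]] by (simp add: rename_rename)
qed (simp_all add: inj_eq rename_subst)

lemma deq_rename: "s \<sim>\<^sub>\<epsilon> t \<Longrightarrow> rename f s \<sim>\<^sub>\<epsilon> rename f t"
proof (induction arbitrary: f rule: deq.induct)
  case (sym s t)
  show ?case by (rule deq.sym) (rule sym.IH)
next
  case (trans s t e)
  show ?case by (rule deq.trans) (rule trans.IH)+
qed (simp_all, (rule deq.intros(1,4-) | assumption)+)

lemma inj_abstract: "inj (\<lambda>y. if y = x then 0 else Suc y)"
  by (rule injI) (auto split: if_splits)

lemma rename_abstract_fresh:
  "x \<notin> fv s \<Longrightarrow> rename (\<lambda>y. if y = x then 0 else Suc y) s = lift s"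
  by (rule rename_cong) auto

lemma fv_lam: "fv (lam x t) = fv t - {x}"
  by (auto simp: lam_def fv_rename split: if_splits)

lemma subst_Var: "t[x ::= Var y] = rename (\<lambda>z. if z = x then y else z) t"
proof (induction t arbitrary: x y)
  case (Lam t)
  show ?case
    by (auto simp: Lam.IH intro!: rename_cong split: nat.split)
qed simp_all

lemma lam_alpha: "y \<notin> fv t \<Longrightarrow> lam x t = lam y (t[x ::= Var y])"
  by (auto simp: lam_def subst_Var rename_rename intro!: rename_cong)

lemma lam_inject: "lam x t = lam x u \<longleftrightarrow> t = u"
proof
  have inv: "rename (case_nat x (\<lambda>y. y)) (rename (\<lambda>y. if y = x then 0 else Suc y) v) = v" for v
  proof -
    have "(\<lambda>y. case_nat x (\<lambda>y. y) (if y = x then 0 else Suc y)) = (\<lambda>y. y)"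
      by (rule ext) simp
    then show ?thesis by (simp add: rename_rename rename_id)
  qed
  assume "lam x t = lam x u"
  then have "rename (\<lambda>y. if y = x then 0 else Suc y) t = rename (\<lambda>y. if y = x then 0 else Suc y) u"
    unfolding lam_def by (rule tm.inject(2)[THEN iffD1])
  then show "t = u" by (metis inv)
qed simp

lemma Lam_eq_lam:
  assumes "x \<notin> fv (Lam t)"
  shows "Lam t = lam x (rename (case_nat x (\<lambda>y. y)) t)"
proof -
  have "rename (\<lambda>y. if case_nat x (\<lambda>y. y) y = x then 0 else Suc (case_nat x (\<lambda>y. y) y)) t
      = rename (\<lambda>y. y) t"
    using assms by (intro rename_cong) (auto split: nat.split)
  then show ?thesis
    unfolding lam_def rename_rename rename_id by (rule arg_cong[OF HOL.sym])
qed

lemma subst_lam: "y \<noteq> x \<Longrightarrow> y \<notin> fv s \<Longrightarrow> (lam y t)[x ::= s] = lam y (t[x ::= s])"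
  by (simp add: lam_def rename_subst[OF inj_abstract] rename_abstract_fresh)

lemma dsubst_lam: "y \<noteq> x \<Longrightarrow> y \<notin> fv s \<Longrightarrow> dsubst (lam y t) x s = lam y (dsubst t x s)"
  by (simp add: lam_def rename_dsubst[OF inj_abstract] rename_abstract_fresh)

lemma deq_lam:
  "t \<sim>\<^sub>\<epsilon> t' \<Longrightarrow> lam x t \<sim>\<^sub>\<epsilon> lam x t'"
  "lam x Zero \<sim>\<^sub>\<epsilon> Zero"
  "lam x (s \<oplus> t) \<sim>\<^sub>\<epsilon> lam x s \<oplus> lam x t"
  "lam x (Eps t) \<sim>\<^sub>\<epsilon> Eps (lam x t)"
  by (simp_all add: lam_def cong_Lam deq_rename Lam_Zero Lam_Plus Lam_Eps)

end

theory Submission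
  imports Defs
begin

text \<open>
  Structural induction on \<open>s\<close>. In the cases of application and \<open>D\<close>, the argument \<open>u[x + \<epsilon>e/x]\<close> in the
  derivative becomes \<open>u[t + \<epsilon>e/x]\<close> after substituting \<open>t\<close>, because \<open>x\<close> is not free in \<open>e\<close>. The
  induction hypothesis for \<open>u\<close> is therefore used in both directions: to expand the left-hand side
  and to rewrite this argument.
\<close>

lemma subst_fresh: "x \<notin> fv t \<Longrightarrow> t[x ::= s] = t"
  by (induction t arbitrary: x s) auto

text \<open>After the first substitution \<open>x\<close> is free only inside the inserted copies of
  \<open>a\<close>, so the second one acts only there. Under a binder, \<open>rename_subst\<close>
  moves \<open>lift\<close> through the substitution.\<close>

lemma subst_subst: "u[x ::= a][x ::= t] = u[x ::= a[x ::= t]]"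
  by (induction u arbitrary: x a t) (simp_all add: rename_subst)

declare deq.trans [trans]

text \<open>The function position is additive and the argument position obeys the Taylor axiom. The
  argument beside \<open>s'\<close> stays unexpanded, as in the derivative of an
  application.\<close>

lemma App_increment:
  "App (s \<oplus> Eps s') (u \<oplus> Eps u') \<sim>\<^sub>\<epsilon> App s u \<oplus> Eps (App (D s u') u \<oplus> App s' (u \<oplus> Eps u'))"
proof -
  have "App (s \<oplus> Eps s') (u \<oplus> Eps u') \<sim>\<^sub>\<epsilon> App s (u \<oplus> Eps u') \<oplus> App (Eps s') (u \<oplus> Eps u')"
    by (rule App_Plus)
  also have "\<dots> \<sim>\<^sub>\<epsilon> (App s u \<oplus> Eps (App (D s u') u)) \<oplus> Eps (App s' (u \<oplus> Eps u'))"
    by (intro cong_Plus App_Taylor App_Eps)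
  also have "\<dots> \<sim>\<^sub>\<epsilon> App s u \<oplus> (Eps (App (D s u') u) \<oplus> Eps (App s' (u \<oplus> Eps u')))"
    by (rule Plus_assoc)
  also have "\<dots> \<sim>\<^sub>\<epsilon> App s u \<oplus> Eps (App (D s u') u \<oplus> App s' (u \<oplus> Eps u'))"
    by (intro cong_Plus deq.refl deq.sym[OF Eps_Plus])
  finally show ?thesis .
qed

text \<open>\<open>D\<close> is additive in its second argument only up to a correction term. This
  term gets one \<open>Eps\<close> from \<open>D_Plus_right\<close> and one from
  \<open>D_Eps_right\<close>; one is factored out, the other stays as in the derivative of
  \<open>D\<close>.\<close>

lemma D_increment_right:
  "D s (u \<oplus> Eps u') \<sim>\<^sub>\<epsilon> D s u \<oplus> Eps (D s u' \<oplus> Eps (D (D s u) u'))"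
proof -
  have "D s (u \<oplus> Eps u') \<sim>\<^sub>\<epsilon> D s u \<oplus> D s (Eps u') \<oplus> Eps (D (D s u) (Eps u'))"
    by (rule D_Plus_right)
  also have "\<dots> \<sim>\<^sub>\<epsilon> D s u \<oplus> Eps (D s u') \<oplus> Eps (Eps (D (D s u) u'))"
    by (intro cong_Plus cong_Eps D_Eps_right deq.refl)
  also have "\<dots> \<sim>\<^sub>\<epsilon> D s u \<oplus> (Eps (D s u') \<oplus> Eps (Eps (D (D s u) u')))"
    by (rule Plus_assoc)
  also have "\<dots> \<sim>\<^sub>\<epsilon> D s u \<oplus> Eps (D s u' \<oplus> Eps (D (D s u) u'))"
    by (intro cong_Plus deq.refl deq.sym[OF Eps_Plus])
  finally show ?thesis .
qed

lemma D_increment: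
  "D (s \<oplus> Eps s') (u \<oplus> Eps u')
    \<sim>\<^sub>\<epsilon> D s u \<oplus> Eps (D s u' \<oplus> D s' (u \<oplus> Eps u') \<oplus> Eps (D (D s u) u'))"
proof -
  let ?a = "D s u'" and ?b = "D s' (u \<oplus> Eps u')" and ?c = "Eps (D (D s u) u')"
  have "D (s \<oplus> Eps s') (u \<oplus> Eps u') \<sim>\<^sub>\<epsilon> D s (u \<oplus> Eps u') \<oplus> D (Eps s') (u \<oplus> Eps u')"
    by (rule D_Plus)
  also have "\<dots> \<sim>\<^sub>\<epsilon> (D s u \<oplus> Eps (?a \<oplus> ?c)) \<oplus> Eps ?b"
    by (intro cong_Plus D_increment_right D_Eps)
  also have "\<dots> \<sim>\<^sub>\<epsilon> D s u \<oplus> (Eps (?a \<oplus> ?c) \<oplus> Eps ?b)"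
    by (rule Plus_assoc)
  also have "\<dots> \<sim>\<^sub>\<epsilon> D s u \<oplus> Eps ((?a \<oplus> ?c) \<oplus> ?b)"
    by (intro cong_Plus deq.refl deq.sym[OF Eps_Plus])
  \<comment> \<open>Reorders the summands to match the \<open>D\<close> clause of
    \<open>dsubst\<close>.\<close>
  also have "\<dots> \<sim>\<^sub>\<epsilon> D s u \<oplus> Eps (?a \<oplus> ?b \<oplus> ?c)"
  proof (rule cong_Plus[OF deq.refl], rule cong_Eps)
    have "(?a \<oplus> ?c) \<oplus> ?b \<sim>\<^sub>\<epsilon> ?a \<oplus> (?c \<oplus> ?b)"
      by (rule Plus_assoc)
    also have "\<dots> \<sim>\<^sub>\<epsilon> ?a \<oplus> (?b \<oplus> ?c)"
      by (intro cong_Plus deq.refl Plus_comm)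
    also have "\<dots> \<sim>\<^sub>\<epsilon> ?a \<oplus> ?b \<oplus> ?c"
      by (rule deq.sym[OF Plus_assoc])
    finally show "(?a \<oplus> ?c) \<oplus> ?b \<sim>\<^sub>\<epsilon> ?a \<oplus> ?b \<oplus> ?c" .
  qed
  finally show ?thesis .
qed

lemma Lam_increment: "Lam (s \<oplus> Eps s') \<sim>\<^sub>\<epsilon> Lam s \<oplus> Eps (Lam s')"
  by (rule deq.trans[OF Lam_Plus]) (intro cong_Plus deq.refl Lam_Eps)

lemma Plus_increment:
  "(s \<oplus> Eps s') \<oplus> (u \<oplus> Eps u') \<sim>\<^sub>\<epsilon> (s \<oplus> u) \<oplus> Eps (s' \<oplus> u')"
proof -
  have "(s \<oplus> Eps s') \<oplus> (u \<oplus> Eps u') \<sim>\<^sub>\<epsilon> s \<oplus> (Eps s' \<oplus> (u \<oplus> Eps u'))"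
    by (rule Plus_assoc)
  also have "\<dots> \<sim>\<^sub>\<epsilon> s \<oplus> ((u \<oplus> Eps u') \<oplus> Eps s')"
    by (intro cong_Plus deq.refl Plus_comm)
  also have "\<dots> \<sim>\<^sub>\<epsilon> s \<oplus> (u \<oplus> (Eps u' \<oplus> Eps s'))"
    by (intro cong_Plus deq.refl Plus_assoc)
  also have "\<dots> \<sim>\<^sub>\<epsilon> (s \<oplus> u) \<oplus> (Eps u' \<oplus> Eps s')"
    by (rule deq.sym[OF Plus_assoc])
  also have "\<dots> \<sim>\<^sub>\<epsilon> (s \<oplus> u) \<oplus> (Eps s' \<oplus> Eps u')"
    by (intro cong_Plus deq.refl Plus_comm)
  also have "\<dots> \<sim>\<^sub>\<epsilon> (s \<oplus> u) \<oplus> Eps (s' \<oplus> u')"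
    by (intro cong_Plus deq.refl deq.sym[OF Eps_Plus])
  finally show ?thesis .
qed

text \<open>Serves \<open>Zero\<close> and the variables other than \<open>x\<close>, whose
  derivative is \<open>Zero\<close>.\<close>

lemma zero_increment: "s \<sim>\<^sub>\<epsilon> s \<oplus> Eps Zero"
  by (rule deq.sym, rule deq.trans[OF cong_Plus[OF deq.refl Eps_Zero] Plus_Zero])

theorem mainTheorem3:
  fixes s t e :: tm and x :: nat
  assumes "x \<notin> fv e"
  shows "s[x ::= t \<oplus> Eps e] \<sim>\<^sub>\<epsilon> s[x ::= t] \<oplus> Eps ((dsubst s x e)[x ::= t])"
  using assms
proof (induction s arbitrary: x t e)
  case (Var y)
  \<comment> \<open>For \<open>y = x\<close> the derivative is \<open>e\<close>, which substituting
    \<open>t\<close> for \<open>x\<close> leaves unchanged.\<close>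
  then show ?case
    by (simp add: subst_fresh deq.refl zero_increment)
next
  case (Lam s)
  \<comment> \<open>Under the binder the hypothesis is needed at \<open>Suc x\<close>,
    \<open>lift t\<close> and \<open>lift e\<close>, hence the generalisation in the
    induction.\<close>
  have "Suc x \<notin> fv (lift e)"
    using Lam.prems by (auto simp: fv_rename)
  from deq.trans[OF cong_Lam[OF Lam.IH[OF this]] Lam_increment]
  show ?case by simp
next
  case (App s u)
  let ?v = "u[x ::= t \<oplus> Eps e]"
  have v: "u[x ::= Var x \<oplus> Eps e][x ::= t] = ?v"
    using App.prems by (simp add: subst_subst subst_fresh)
  note IH = App.IH[OF App.prems, of t]
  \<comment> \<open>\<open>App_increment\<close> leaves an expanded argument beside the derivative
    of \<open>s\<close>, where the goal has \<open>?v\<close>; \<open>IH(2)\<close> reversed closes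
    this gap.\<close>
  show ?case
    unfolding subst.simps dsubst.simps v
    by (rule deq.trans[OF cong_App[OF IH]], rule deq.trans[OF App_increment])
      (intro cong_Plus cong_Eps cong_App deq.refl deq.sym[OF IH(2)])
next
  case (D s u)
  let ?v = "u[x ::= t \<oplus> Eps e]"
  have v: "u[x ::= Var x \<oplus> Eps e][x ::= t] = ?v"
    using D.prems by (simp add: subst_subst subst_fresh)
  note IH = D.IH[OF D.prems, of t]
  show ?case
    unfolding subst.simps dsubst.simps v
    by (rule deq.trans[OF cong_D[OF IH]], rule deq.trans[OF D_increment])
      (intro cong_Plus cong_Eps cong_D deq.refl deq.sym[OF IH(2)])
next
  case (Eps s)
  show ?case
    using deq.trans[OF cong_Eps[OF Eps.IH[OF Eps.prems]] Eps_Plus] by simp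
next
  case (Plus s u)
  show ?case
    using deq.trans[OF cong_Plus[OF Plus.IH[OF Plus.prems]] Plus_increment] by simp
next
  case Zero
  show ?case by (simp add: zero_increment)
qed

end
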